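(* Let $n \ge 1$ and let $A = [a_{ij}]$ be a real $n \times n$ matrix (not assumed to be symmetric). For each $i \in \{1,\dots,n\}$ put $R_i(A) = \sum_{j \neq i} |a_{ij}|$. Suppose that, for all $i \in \{1,\dots,n\}$, 1. $|a_{ii}| \geq R_i(A)$, and 2. $a_{ii} \geq 0$. Then $A$ is positive semidefinite in the sense that all principal minors of $A$ are nonnegative, i.e. $\det\big([a_{ij}]_{i,j \in Y}\big) \geq 0$ for every nonempty subset $Y \subseteq \{1,\dots,n\}$.
   Context: Here "positive semidefinite" is applied to real square matrices that need not be symmetric, and it means that every principal minor is nonnegative. This is the property required for a matrix $L$ to define a determinantal point process on subsets of $\{1,\dots,n\}$ via $\mathcal{P}_L(\mathbf{Y}=Y) = \det(L_Y)/\det(L+\mathrm{I})$, where $L_Y$ is the submatrix of $L$ with rows and columns indexed by $Y$. It is not the condition $x^\top A x \ge 0$ for all $x$. *)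

theory Defs
  imports
    Complex_Main
    "Jordan_Normal_Form.Determinant"
    "Jordan_Normal_Form.DL_Submatrix"
begin

text \<open>Rows and columns of an n-by-n matrix are indexed by \<open>{0..<n}\<close>.\<close>

definition deleted_row_sum :: "real mat \<Rightarrow> nat \<Rightarrow> real" where
  "deleted_row_sum A i = (\<Sum>j\<in>{0..<dim_col A} - {i}. \<bar>A $$ (i, j)\<bar>)"

definition principal_minor :: "real mat \<Rightarrow> nat set \<Rightarrow> real" where
  "principal_minor A Y = det (submatrix A Y Y)"

text \<open>Positive semidefiniteness in the sense used for kernels of determinantal point
  processes. The matrix need not be symmetric, and this is not the condition that
  the quadratic form of the matrix be nonnegative.\<close>

definition positive_semidefinite :: "real mat \<Rightarrow> bool" where
  "positive_semidefinite A \<longleftrightarrow>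
     square_mat A \<and>
     (\<forall>Y. Y \<noteq> {} \<longrightarrow> Y \<subseteq> {0..<dim_row A} \<longrightarrow> principal_minor A Y \<ge> 0)"

end

(* A real eigenvalue of -M for a diagonally dominant M with nonnegative diagonal cannot be positive:
   compare the two sides of the eigenvalue equation at the entry of largest modulus. Hence the
   monic polynomial t |-> det (M + t I) has no positive root, so by the intermediate value
   theorem it is nonnegative at t = 0. Both hypotheses pass to principal submatrices. *)

theory Submission
  imports Defs "Jordan_Normal_Form.Char_Poly"
begin

lemma monic_poly_nonneg_at_0:
  fixes p :: "real poly"
  assumes "lead_coeff p > 0" and "\<And>t. t > 0 \<Longrightarrow> poly p t \<noteq> 0"
  shows "poly p 0 \<ge> 0"
proof (rule ccontr)
  assume "\<not> poly p 0 \<ge> 0"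
  then have neg: "poly p 0 < 0" by simp
  obtain b where b: "\<And>t. t \<ge> b \<Longrightarrow> poly p t \<ge> lead_coeff p"
    using poly_pinfty_gt_lc[OF assms(1)] by blast
  \<comment> \<open>The bound \<open>b\<close> may be negative; \<open>max b 1\<close> keeps the
    right endpoint positive, so that the intermediate value theorem yields a root in the excluded
    range.\<close>
  have "poly p (max b 1) > 0"
    using b[of "max b 1"] assms(1) by linarith
  moreover have "0 < max b 1" by simp
  ultimately obtain t where "t > 0" "poly p t = 0"
    using poly_IVT_pos[of 0 "max b 1" p] neg by blast
  then show False using assms(2) by blast
qed

text \<open>Evaluation at 0 commutes with \<open>det\<close> and turns the matrix X I + M into M.
  Working with \<open>- M\<close> avoids the sign (-1)^k.\<close>

lemma det_eq_poly_char_poly_uminus: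
  fixes M :: "'a :: comm_ring_1 mat"
  assumes "M \<in> carrier_mat k k"
  shows "poly (char_poly (- M)) 0 = det M"
  unfolding char_poly_def
  by (rule poly_det_cong[of _ k]) (use assms in \<open>auto simp: char_poly_matrix_def\<close>)

text \<open>Gershgorin's argument. The hypothesis \<open>dom\<close> encodes both dominance and a
  nonnegative diagonal, since deleted row sums are nonnegative.\<close>

lemma diagonally_dominant_no_pos_eigenvalue_uminus:
  fixes M :: "real mat"
  assumes M: "M \<in> carrier_mat k k"
    and dom: "\<And>i. i < k \<Longrightarrow> deleted_row_sum M i \<le> M $$ (i, i)"
    and "t > 0"
  shows "\<not> eigenvalue (- M) t"
proof
  assume "eigenvalue (- M) t"
  then obtain v where v: "v \<in> carrier_vec k" "v \<noteq> 0\<^sub>v k" "- M *\<^sub>v v = t \<cdot>\<^sub>v v"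
    using M unfolding eigenvalue_def eigenvector_def by auto
  \<comment> \<open>A nonzero entry makes the largest modulus positive, so it can be cancelled at
    the end.\<close>
  obtain l where l: "l < k" "v $ l \<noteq> 0"
    using v(1,2) by (metis eq_vecI carrier_vecD index_zero_vec)
  define m where "m = Max ((\<lambda>i. \<bar>v $ i\<bar>) ` {0..<k})"
  have "m \<in> (\<lambda>i. \<bar>v $ i\<bar>) ` {0..<k}"
    unfolding m_def using l(1) by (intro Max_in) auto
  then obtain i where i: "i < k" "\<bar>v $ i\<bar> = m" by auto
  have max: "\<bar>v $ j\<bar> \<le> \<bar>v $ i\<bar>" if "j < k" for j
    unfolding i(2) m_def using that by (intro Max_ge) auto
  have pos: "\<bar>v $ i\<bar> > 0" using max[OF l(1)] l(2) by simp
  have "(- M *\<^sub>v v) $ i = (\<Sum>j\<in>{0..<k}. - (M $$ (i, j) * v $ j))"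
    using M v(1) i(1) by (auto simp: scalar_prod_def sum_negf)
  also have "\<dots> = - (M $$ (i, i) * v $ i) - (\<Sum>j\<in>{0..<k} - {i}. M $$ (i, j) * v $ j)"
    using i(1) by (subst sum.remove[of _ i]) (auto simp: sum_negf)
  \<comment> \<open>Row \<open>i\<close> of the eigenvalue equation, with the diagonal term moved to
    the left.\<close>
  finally have "(t + M $$ (i, i)) * v $ i = - (\<Sum>j\<in>{0..<k} - {i}. M $$ (i, j) * v $ j)"
    using v i(1) by (simp add: algebra_simps)
  then have "\<bar>t + M $$ (i, i)\<bar> * \<bar>v $ i\<bar> = \<bar>\<Sum>j\<in>{0..<k} - {i}. M $$ (i, j) * v $ j\<bar>"
    by (metis abs_minus_cancel abs_mult)
  also have "\<dots> \<le> (\<Sum>j\<in>{0..<k} - {i}. \<bar>M $$ (i, j)\<bar> * \<bar>v $ i\<bar>)"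
    by (rule order_trans[OF sum_abs]) (auto simp: abs_mult intro!: sum_mono mult_left_mono max)
  also have "\<dots> = deleted_row_sum M i * \<bar>v $ i\<bar>"
    using M by (simp add: deleted_row_sum_def sum_distrib_right)
  finally have "\<bar>t + M $$ (i, i)\<bar> \<le> deleted_row_sum M i"
    using pos by simp
  \<comment> \<open>The contradiction is t + M_ii > M_ii \<ge> R_i \<ge> |t + M_ii|, where R_i is
    the deleted row sum.\<close>
  then show False using dom[OF i(1)] \<open>t > 0\<close> by linarith
qed

lemma diagonally_dominant_det_nonneg:
  fixes M :: "real mat"
  assumes M: "M \<in> carrier_mat k k"
    and dom: "\<And>i. i < k \<Longrightarrow> deleted_row_sum M i \<le> M $$ (i, i)"
  shows "det M \<ge> 0"
proof -
  have N: "- M \<in> carrier_mat k k" using M by simp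
  have "poly (char_poly (- M)) t \<noteq> 0" if "t > 0" for t
    using diagonally_dominant_no_pos_eigenvalue_uminus[OF M dom that]
      eigenvalue_root_char_poly[OF N] by blast
  moreover have "lead_coeff (char_poly (- M)) > 0"
    using degree_monic_char_poly[OF N] by simp
  ultimately have "poly (char_poly (- M)) 0 \<ge> 0"
    by (intro monic_poly_nonneg_at_0)
  then show ?thesis using det_eq_poly_char_poly_uminus[OF M] by simp
qed

text \<open>\<open>pick Y\<close> enumerates \<open>Y\<close> increasingly, so the left side is the
  part of the right-hand sum with columns in \<open>Y\<close>; the omitted terms are absolute
  values.\<close>

lemma deleted_row_sum_submatrix_le:
  assumes A: "A \<in> carrier_mat n n" and Y: "Y \<subseteq> {0..<n}" and i: "i < card Y"
  shows "deleted_row_sum (submatrix A Y Y) i \<le> deleted_row_sum A (pick Y i)"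
proof -
  have Yn: "{j. j < n \<and> j \<in> Y} = Y" using Y by auto
  have inj: "inj_on (pick Y) ({0..<card Y} - {i})"
    by (rule inj_onI) (metis DiffD1 atLeastLessThan_iff nat_neq_iff pick_mono_le)
  \<comment> \<open>Strict monotonicity of \<open>pick Y\<close> also keeps the diagonal column
    \<open>pick Y i\<close> out of the image.\<close>
  have sub: "pick Y ` ({0..<card Y} - {i}) \<subseteq> {0..<n} - {pick Y i}"
  proof
    fix x assume "x \<in> pick Y ` ({0..<card Y} - {i})"
    then obtain j where "j \<in> {0..<card Y} - {i}" and jx: "x = pick Y j" by blast
    then have j: "j < card Y" "j \<noteq> i" by auto
    then have "x \<noteq> pick Y i" using i jx by (metis nat_neq_iff pick_mono_le)
    then show "x \<in> {0..<n} - {pick Y i}" using jx pick_in_set_le[OF j(1)] Y by auto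
  qed
  have "deleted_row_sum (submatrix A Y Y) i
      = (\<Sum>j\<in>{0..<card Y} - {i}. \<bar>A $$ (pick Y i, pick Y j)\<bar>)"
    unfolding deleted_row_sum_def using A i
    by (auto simp: dim_submatrix submatrix_index Yn intro!: sum.cong)
  also have "\<dots> = (\<Sum>j\<in>pick Y ` ({0..<card Y} - {i}). \<bar>A $$ (pick Y i, j)\<bar>)"
    by (simp add: sum.reindex[OF inj])
  also have "\<dots> \<le> deleted_row_sum A (pick Y i)"
    unfolding deleted_row_sum_def using A sub by (auto intro!: sum_mono2)
  finally show ?thesis .
qed

theorem proposition1:
  fixes n :: nat and A :: "real mat"
  assumes "n \<ge> 1"
    and "A \<in> carrier_mat n n"
    and "\<And>i. i < n \<Longrightarrow> \<bar>A $$ (i, i)\<bar> \<ge> deleted_row_sum A i"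
    and "\<And>i. i < n \<Longrightarrow> A $$ (i, i) \<ge> 0"
  shows "positive_semidefinite A"
  unfolding positive_semidefinite_def principal_minor_def
proof (intro conjI allI impI)
  show "square_mat A" using assms(2) by auto
next
  fix Y assume "Y \<subseteq> {0..<dim_row A}"
  then have Y: "Y \<subseteq> {0..<n}" using assms(2) by simp
  then have Yn: "{j. j < n \<and> j \<in> Y} = Y" by auto
  show "det (submatrix A Y Y) \<ge> 0"
  proof (rule diagonally_dominant_det_nonneg)
    show "submatrix A Y Y \<in> carrier_mat (card Y) (card Y)"
      using assms(2) by (intro carrier_matI) (simp_all add: dim_submatrix Yn)
  next
    fix i assume i: "i < card Y"
    have p: "pick Y i < n" using pick_in_set_le[OF i] Y by auto
    \<comment> \<open>Nonnegativity of the diagonal removes the absolute value in the dominance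
      hypothesis.\<close>
    have "deleted_row_sum (submatrix A Y Y) i \<le> A $$ (pick Y i, pick Y i)"
      using deleted_row_sum_submatrix_le[OF assms(2) Y i] assms(3,4)[OF p] by linarith
    also have "\<dots> = submatrix A Y Y $$ (i, i)"
      using assms(2) i by (simp add: submatrix_index Yn)
    finally show "deleted_row_sum (submatrix A Y Y) i \<le> submatrix A Y Y $$ (i, i)" .
  qed
qed

end
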